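(* Let $G=(V,E)$ be a connected graph with $E(G)\neq\varnothing$. The following two statements are equivalent: (i) There exists a strictly positive pseudoultrametrizable weight $w:E(G)\to\mathbb{R}^+$ such that the set $\mathfrak{U}_w$ of all pseudoultrametrics on $V(G)$ extending $w$ does not contain any ultrametric; (ii) There exist distinct vertices $u^*,v^*\in V(G)$ and a sequence $\{F_j\}_{j\in\mathbb{N}}$ of paths $F_j\in\mathfrak{P}_{u^*,v^*}$ such that $$\limsup_{j\to\infty}V(F_j)$$ is an independent set.
   Context: A graph $G=(V(G),E(G))$ has a nonempty (possibly infinite) vertex set $V(G)$, and its edge set $E(G)$ (possibly empty) is a set of unordered pairs of distinct vertices. A path is a finite graph with at least one edge whose vertices can be enumerated without repetition as $v_1,\dots,v_n$ so that $\{v_i,v_j\}$ is an edge iff $|i-j|=1$; it connects $v_1$ and $v_n$. For distinct $u,v\in V(G)$, $\mathfrak{P}_{u,v}$ is the set of paths in $G$ (subgraphs of $G$, not necessarily induced) connecting $u$ and $v$. $G$ is connected if any two distinct vertices are connected by a path in $G$. A weight on $G$ is a function $w:E(G)\to\mathbb{R}^+=[0,+\infty)$; it is strictly positive if $w(e)>0$ for every $e\in E(G)$. A pseudoultrametric on a set $X$ is a function $d:X\times X\to\mathbb{R}^+$ with $d(x,y)=d(y,x)$, $d(x,x)=0$ and $d(x,y)\le\max\{d(x,z),d(z,y)\}$ for all $x,y,z\in X$; it is an ultrametric if moreover $d(x,y)=0$ implies $x=y$. A pseudoultrametric $d$ on $V(G)$ extends $w$ if $d(x,y)=w(\{x,y\})$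 for every $\{x,y\}\in E(G)$. The weight $w$ is pseudoultrametrizable if some pseudoultrametric on $V(G)$ extends $w$. For sets $A_n$, $n\in\mathbb{N}$, $\limsup_{n\to\infty}A_n=\bigcap_{k=1}^{\infty}\bigcup_{n=1}^{\infty}A_{n+k}$ is the set of elements belonging to $A_n$ for infinitely many $n$. A subset of $V(G)$ is independent if no two of its vertices are adjacent. *)

theory Defs
  imports Complex_Main "HOL-Library.Liminf_Limsup"
begin

record 'a ugraph =
  verts :: "'a set"
  edges :: "'a set set"

definition is_graph :: "'a ugraph \<Rightarrow> bool" where
  "is_graph G \<longleftrightarrow> verts G \<noteq> {} \<and>
     edges G \<subseteq> {{u, v} | u v. u \<in> verts G \<and> v \<in> verts G \<and> u \<noteq> v}"

definition subgraph_of :: "'a ugraph \<Rightarrow> 'a ugraph \<Rightarrow> bool" where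
  "subgraph_of F G \<longleftrightarrow>
     is_graph F \<and> is_graph G \<and> verts F \<subseteq> verts G \<and> edges F \<subseteq> edges G"

(* The list vs is an enumeration v_1, ..., v_n witnessing that F is a path;
   finiteness of F is implied by verts F = set vs. *)
definition path_enum :: "'a list \<Rightarrow> 'a ugraph \<Rightarrow> bool" where
  "path_enum vs F \<longleftrightarrow> is_graph F \<and> edges F \<noteq> {} \<and> distinct vs \<and> verts F = set vs \<and>
     (\<forall>i < length vs. \<forall>j < length vs.
        {vs ! i, vs ! j} \<in> edges F \<longleftrightarrow> \<bar>int i - int j\<bar> = 1)"

definition is_path_connecting :: "'a ugraph \<Rightarrow> 'a \<Rightarrow> 'a \<Rightarrow> bool" where
  "is_path_connecting F u v \<longleftrightarrow> (\<exists>vs. path_enum vs F \<and> hd vs = u \<and> last vs = v)"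

definition paths_between :: "'a ugraph \<Rightarrow> 'a \<Rightarrow> 'a \<Rightarrow> 'a ugraph set" where
  "paths_between G u v = {F. subgraph_of F G \<and> is_path_connecting F u v}"

definition connected_graph :: "'a ugraph \<Rightarrow> bool" where
  "connected_graph G \<longleftrightarrow>
     (\<forall>u \<in> verts G. \<forall>v \<in> verts G. u \<noteq> v \<longrightarrow> paths_between G u v \<noteq> {})"

definition independent_set :: "'a ugraph \<Rightarrow> 'a set \<Rightarrow> bool" where
  "independent_set G S \<longleftrightarrow> S \<subseteq> verts G \<and> (\<forall>x \<in> S. \<forall>y \<in> S. {x, y} \<notin> edges G)"

(* Functions on E(G), and on X * X below, are total HOL functions of which only
   the values on the stated domain matter. *)
definition weight :: "'a ugraph \<Rightarrow> ('a set \<Rightarrow> real) \<Rightarrow> bool" where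
  "weight G w \<longleftrightarrow> (\<forall>e \<in> edges G. 0 \<le> w e)"

definition strictly_positive :: "'a ugraph \<Rightarrow> ('a set \<Rightarrow> real) \<Rightarrow> bool" where
  "strictly_positive G w \<longleftrightarrow> (\<forall>e \<in> edges G. 0 < w e)"

definition pseudoultrametric_on :: "'a set \<Rightarrow> ('a \<Rightarrow> 'a \<Rightarrow> real) \<Rightarrow> bool" where
  "pseudoultrametric_on X d \<longleftrightarrow>
     (\<forall>x \<in> X. \<forall>y \<in> X. 0 \<le> d x y) \<and>
     (\<forall>x \<in> X. \<forall>y \<in> X. d x y = d y x) \<and>
     (\<forall>x \<in> X. d x x = 0) \<and>
     (\<forall>x \<in> X. \<forall>y \<in> X. \<forall>z \<in> X. d x y \<le> max (d x z) (d z y))"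

definition ultrametric_on :: "'a set \<Rightarrow> ('a \<Rightarrow> 'a \<Rightarrow> real) \<Rightarrow> bool" where
  "ultrametric_on X d \<longleftrightarrow>
     pseudoultrametric_on X d \<and> (\<forall>x \<in> X. \<forall>y \<in> X. d x y = 0 \<longrightarrow> x = y)"

definition extends_weight :: "'a ugraph \<Rightarrow> ('a set \<Rightarrow> real) \<Rightarrow> ('a \<Rightarrow> 'a \<Rightarrow> real) \<Rightarrow> bool" where
  "extends_weight G w d \<longleftrightarrow>
     (\<forall>x \<in> verts G. \<forall>y \<in> verts G. {x, y} \<in> edges G \<longrightarrow> d x y = w {x, y})"

definition pseudoultrametric_extensions ::
    "'a ugraph \<Rightarrow> ('a set \<Rightarrow> real) \<Rightarrow> ('a \<Rightarrow> 'a \<Rightarrow> real) set" where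
  "pseudoultrametric_extensions G w =
     {d. pseudoultrametric_on (verts G) d \<and> extends_weight G w d}"

definition pseudoultrametrizable :: "'a ugraph \<Rightarrow> ('a set \<Rightarrow> real) \<Rightarrow> bool" where
  "pseudoultrametrizable G w \<longleftrightarrow>
     (\<exists>d. pseudoultrametric_on (verts G) d \<and> extends_weight G w d)"

(* The order-theoretic limsup on the complete lattice of sets is the set-theoretic
   upper limit; shifting the index of the sequence by one does not affect it. *)
lemma limsup_set_eq:
  fixes A :: "nat \<Rightarrow> 'a set"
  shows "limsup A = (\<Inter>k\<in>{1..}. \<Union>n\<in>{1..}. A (n + k))"
proof (intro set_eqI iffI)
  fix x assume x: "x \<in> limsup A"
  show "x \<in> (\<Inter>k\<in>{1..}. \<Union>n\<in>{1..}. A (n + k))"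
  proof
    fix k :: nat
    from x have "x \<in> (\<Union>m\<in>{Suc k..}. A m)"
      unfolding limsup_INF_SUP by blast
    then obtain m where "m \<ge> Suc k" "x \<in> A m" by auto
    then have "m - k \<in> {1..}" "x \<in> A ((m - k) + k)" by auto
    then show "x \<in> (\<Union>n\<in>{1..}. A (n + k))" by blast
  qed
next
  fix x assume x: "x \<in> (\<Inter>k\<in>{1..}. \<Union>n\<in>{1..}. A (n + k))"
  have "x \<in> (\<Union>m\<in>{k..}. A m)" for k
  proof -
    have "Suc k \<in> {1..}" by simp
    with x have "x \<in> (\<Union>n\<in>{1..}. A (n + Suc k))" by blast
    then obtain n where "x \<in> A (n + Suc k)" by blast
    moreover have "n + Suc k \<in> {k..}" by simp
    ultimately show ?thesis by blast
  qed
  then show "x \<in> limsup A" unfolding limsup_INF_SUP by blast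
qed

end

theory Submission imports Defs "HOL-Library.Infinite_Set" begin

text \<open>
  Both directions turn on one observation: in a pseudoultrametric extending \<open>w\<close>, two vertices
  joined by a walk all of whose edges weigh at most \<open>r \<ge> 0\<close> are at distance at most \<open>r\<close>
  (\<open>dist_le_if_light_walk\<close>). The infimum of such \<open>r\<close>, the bottleneck distance of the two vertices,
  is therefore the largest pseudoultrametric extending a pseudoultrametrizable \<open>w\<close>
  (\<open>bottleneck_in_extensions\<close>), and an ultrametric extension can be missing only if some two
  distinct vertices \<open>u\<close>, \<open>v\<close> have bottleneck distance \<open>0\<close>, that is, are joined by
  paths \<open>F j\<close> of arbitrarily small edge weights.

  Suppose \<open>w\<close> is strictly positive and such paths exist. A vertex on infinitely many of them is at
  distance \<open>0\<close> from \<open>u\<close> in every extension of \<open>w\<close>, so two such vertices are at distance \<open>0\<close>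
  from each other and no edge, having positive weight, can join them: the upper limit of the
  vertex sets is independent (\<open>independent_limsup_light_paths\<close>).

  Conversely, from paths \<open>F j\<close> with independent upper limit \<open>L\<close>, give every vertex a height that
  vanishes exactly on \<open>L\<close> and is at most \<open>1 / (j + 1)\<close> on \<open>F j\<close>, and let an edge weigh the larger
  of the heights of its ends. Independence of \<open>L\<close> makes this weight strictly positive, while the
  light paths \<open>F j\<close> force \<open>u\<close> and \<open>v\<close> to be at distance \<open>0\<close> in every extension. An extension
  exists because the maximum of heights, set to \<open>0\<close> on the diagonal, is a pseudoultrametric
  (\<open>pseudoultrametric_max_height\<close>).
\<close>

section \<open>Walks with light edges\<close>

definition light_edges :: "'a ugraph \<Rightarrow> ('a set \<Rightarrow> real) \<Rightarrow> real \<Rightarrow> ('a \<times> 'a) set" where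
  "light_edges G w r = {(x, y). {x, y} \<in> edges G \<and> w {x, y} \<le> r}"

lemma edge_verts:
  assumes "is_graph G" "{x, y} \<in> edges G"
  shows "x \<in> verts G" "y \<in> verts G" "x \<noteq> y"
  using assms by (auto simp: is_graph_def doubleton_eq_iff)

lemma light_walk_mono:
  assumes "(x, y) \<in> (light_edges G w r)\<^sup>*" "r \<le> s"
  shows "(x, y) \<in> (light_edges G w s)\<^sup>*"
proof -
  have "light_edges G w r \<subseteq> light_edges G w s"
    using assms(2) by (auto simp: light_edges_def)
  then show ?thesis using assms(1) rtrancl_mono by blast
qed

lemma light_walk_sym:
  assumes "(x, y) \<in> (light_edges G w r)\<^sup>*"
  shows "(y, x) \<in> (light_edges G w r)\<^sup>*"
proof -
  have "sym (light_edges G w r)"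
    by (auto simp: sym_def light_edges_def insert_commute)
  then show ?thesis using assms by (meson sym_rtrancl symD)
qed

text \<open>
  The strong triangle inequality, iterated along a walk, bounds the distance of its ends by
  its heaviest edge.
\<close>

lemma dist_le_if_light_walk:
  assumes G: "is_graph G" and d: "d \<in> pseudoultrametric_extensions G w"
    and x: "x \<in> verts G" and r: "0 \<le> r" and walk: "(x, y) \<in> (light_edges G w r)\<^sup>*"
  shows "d x y \<le> r"
proof -
  have "y \<in> verts G \<and> d x y \<le> r"
    using walk
  proof (induction rule: rtrancl_induct)
    case base
    show ?case using d x r
      by (simp add: pseudoultrametric_extensions_def pseudoultrametric_on_def)
  next
    case (step y z)
    from step have e: "{y, z} \<in> edges G" "w {y, z} \<le> r" by (auto simp: light_edges_def)
    note vs = edge_verts[OF G e(1)]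
    have "d y z = w {y, z}"
      using d e vs by (simp add: pseudoultrametric_extensions_def extends_weight_def)
    moreover have "d x z \<le> max (d x y) (d y z)"
      using d x vs by (simp add: pseudoultrametric_extensions_def pseudoultrametric_on_def)
    ultimately show ?case using step e vs by auto
  qed
  then show ?thesis ..
qed

section \<open>Paths and light walks\<close>

lemma path_vertex_light_walk:
  assumes F: "F \<in> paths_between G u v"
    and light: "\<And>e. e \<in> edges F \<Longrightarrow> w e \<le> r"
    and x: "x \<in> verts F"
  shows "(u, x) \<in> (light_edges G w r)\<^sup>*"
proof -
  obtain vs where vs: "path_enum vs F" "hd vs = u"
    using F by (auto simp: paths_between_def is_path_connecting_def)
  have walk: "(u, vs ! i) \<in> (light_edges G w r)\<^sup>*" if "i < length vs" for i
    using that
  proof (induction i)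
    case 0
    then show ?case using vs(2) by (simp add: hd_conv_nth)
  next
    case (Suc i)
    then have "{vs ! i, vs ! Suc i} \<in> edges F"
      using vs(1) by (simp add: path_enum_def)
    then have "(vs ! i, vs ! Suc i) \<in> light_edges G w r"
      using F light by (auto simp: light_edges_def paths_between_def subgraph_of_def)
    with Suc show ?case by (meson Suc_lessD rtrancl.rtrancl_into_rtrancl)
  qed
  have "x \<in> set vs" using x vs(1) by (simp add: path_enum_def)
  then show ?thesis using walk by (auto simp: in_set_conv_nth)
qed

lemma path_ends:
  assumes "F \<in> paths_between G u v"
  shows "u \<in> verts F" "v \<in> verts F"
proof -
  obtain vs where vs: "path_enum vs F" "hd vs = u" "last vs = v"
    using assms by (auto simp: paths_between_def is_path_connecting_def)
  then have "vs \<noteq> []" by (auto simp: path_enum_def is_graph_def)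
  then show "u \<in> verts F" "v \<in> verts F"
    using vs by (auto simp: path_enum_def)
qed

text \<open>Cutting a walk at the first visit to a vertex that it revisits leaves no repetition.\<close>

lemma rtrancl_distinct_list:
  assumes "(x, y) \<in> R\<^sup>*"
  obtains xs where "xs \<noteq> []" "distinct xs" "hd xs = x" "last xs = y"
    "successively (\<lambda>a b. (a, b) \<in> R) xs"
proof -
  have "\<exists>xs. xs \<noteq> [] \<and> distinct xs \<and> hd xs = x \<and> last xs = y \<and>
      successively (\<lambda>a b. (a, b) \<in> R) xs"
    using assms
  proof (induction rule: rtrancl_induct)
    case base
    show ?case by (rule exI[of _ "[x]"]) simp
  next
    case (step y z)
    then obtain xs where xs: "xs \<noteq> []" "distinct xs" "hd xs = x" "last xs = y"
      "successively (\<lambda>a b. (a, b) \<in> R) xs" by blast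
    show ?case
    proof (cases "z \<in> set xs")
      case True
      then obtain ys zs where split: "xs = ys @ z # zs" by (meson split_list)
      have "hd (ys @ [z]) = x" using xs(3) split by (cases ys) auto
      then show ?thesis using xs split
        by (intro exI[of _ "ys @ [z]"]) (auto simp: successively_append_iff)
    next
      case False
      then show ?thesis using xs step(2)
        by (intro exI[of _ "xs @ [z]"]) (auto simp: successively_append_iff)
    qed
  qed
  then show thesis using that by blast
qed

definition list_graph :: "'a list \<Rightarrow> 'a ugraph" where
  "list_graph xs = \<lparr>verts = set xs, edges = {{xs ! i, xs ! Suc i} | i. Suc i < length xs}\<rparr>"

lemma path_enum_list_graph:
  assumes xs: "distinct xs" and len: "2 \<le> length xs"
  shows "path_enum xs (list_graph xs)"
proof -
  have "{xs ! i, xs ! j} \<in> edges (list_graph xs) \<longleftrightarrow> \<bar>int i - int j\<bar> = 1"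
    if ij: "i < length xs" "j < length xs" for i j
  proof
    assume "{xs ! i, xs ! j} \<in> edges (list_graph xs)"
    then obtain k where k: "Suc k < length xs" "{xs ! i, xs ! j} = {xs ! k, xs ! Suc k}"
      by (auto simp: list_graph_def)
    then have "i = k \<and> j = Suc k \<or> i = Suc k \<and> j = k"
      using ij xs by (auto simp: doubleton_eq_iff nth_eq_iff_index_eq)
    then show "\<bar>int i - int j\<bar> = 1" by auto
  next
    assume "\<bar>int i - int j\<bar> = 1"
    then have "j = Suc i \<or> i = Suc j" by auto
    then show "{xs ! i, xs ! j} \<in> edges (list_graph xs)"
      using ij by (auto simp: list_graph_def insert_commute)
  qed
  moreover have "edges (list_graph xs) \<noteq> {}"
    using len by (auto simp: list_graph_def intro!: exI[of _ 0])
  moreover have "is_graph (list_graph xs)"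
  proof -
    have "\<exists>u v. {xs ! i, xs ! Suc i} = {u, v} \<and> u \<in> set xs \<and> v \<in> set xs \<and> u \<noteq> v"
      if "Suc i < length xs" for i
      using that xs by (intro exI[of _ "xs ! i"] exI[of _ "xs ! Suc i"])
        (simp add: nth_eq_iff_index_eq)
    moreover have "set xs \<noteq> {}" using len by auto
    ultimately show ?thesis by (auto simp: is_graph_def list_graph_def)
  qed
  ultimately show ?thesis
    using xs by (simp add: path_enum_def) (simp add: list_graph_def)
qed

lemma light_walk_path:
  assumes G: "is_graph G" and x: "x \<in> verts G" and "x \<noteq> y"
    and walk: "(x, y) \<in> (light_edges G w r)\<^sup>*"
  obtains F where "F \<in> paths_between G x y" "\<And>e. e \<in> edges F \<Longrightarrow> w e \<le> r"
proof -
  obtain xs where xs: "xs \<noteq> []" "distinct xs" "hd xs = x" "last xs = y"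
    and succ: "successively (\<lambda>a b. (a, b) \<in> light_edges G w r) xs"
    using rtrancl_distinct_list[OF walk] .
  have len: "2 \<le> length xs"
    using xs \<open>x \<noteq> y\<close> by (cases xs; cases "tl xs") auto
  have path: "path_enum xs (list_graph xs)"
    using path_enum_list_graph[OF xs(2) len] .
  have step: "{xs ! i, xs ! Suc i} \<in> edges G \<and> w {xs ! i, xs ! Suc i} \<le> r"
    if "Suc i < length xs" for i
    using succ that by (auto simp: successively_conv_nth light_edges_def)
  have "z \<in> verts G" if "z \<in> set xs" for z
  proof -
    obtain i where i: "i < length xs" "z = xs ! i" using \<open>z \<in> set xs\<close> by (auto simp: in_set_conv_nth)
    show ?thesis
    proof (cases i)
      case 0
      then show ?thesis using i x xs by (simp add: hd_conv_nth)
    next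
      case (Suc k)
      then show ?thesis using i step[of k] edge_verts[OF G] by blast
    qed
  qed
  then have "subgraph_of (list_graph xs) G"
    using G path step by (auto simp: subgraph_of_def path_enum_def list_graph_def)
  then have "list_graph xs \<in> paths_between G x y"
    using path xs by (auto simp: paths_between_def is_path_connecting_def)
  moreover have "w e \<le> r" if "e \<in> edges (list_graph xs)" for e
    using that step by (auto simp: list_graph_def)
  ultimately show thesis using that by blast
qed

section \<open>The bottleneck distance\<close>

definition bottleneck_bounds :: "'a ugraph \<Rightarrow> ('a set \<Rightarrow> real) \<Rightarrow> 'a \<Rightarrow> 'a \<Rightarrow> real set" where
  "bottleneck_bounds G w x y = {r. 0 \<le> r \<and> (x, y) \<in> (light_edges G w r)\<^sup>*}"

definition bottleneck :: "'a ugraph \<Rightarrow> ('a set \<Rightarrow> real) \<Rightarrow> 'a \<Rightarrow> 'a \<Rightarrow> real" where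
  "bottleneck G w x y = Inf (bottleneck_bounds G w x y)"

lemma bdd_below_bottleneck_bounds: "bdd_below (bottleneck_bounds G w x y)"
  by (rule bdd_belowI[of _ 0]) (simp add: bottleneck_bounds_def)

lemma bottleneck_le: "r \<in> bottleneck_bounds G w x y \<Longrightarrow> bottleneck G w x y \<le> r"
  unfolding bottleneck_def by (rule cInf_lower[OF _ bdd_below_bottleneck_bounds])

lemma bottleneck_bounds_nonempty:
  assumes "connected_graph G" "x \<in> verts G" "y \<in> verts G"
  shows "bottleneck_bounds G w x y \<noteq> {}"
proof (cases "x = y")
  case True
  then have "0 \<in> bottleneck_bounds G w x y" by (simp add: bottleneck_bounds_def)
  then show ?thesis by blast
next
  case False
  then obtain F where F: "F \<in> paths_between G x y"
    using assms unfolding connected_graph_def by blast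
  then have "is_graph F" "finite (verts F)"
    by (auto simp: paths_between_def is_path_connecting_def path_enum_def)
  then have fin: "finite (edges F)"
    by (intro finite_subset[of "edges F" "Pow (verts F)"]) (auto simp: is_graph_def)
  \<comment> \<open>Including \<open>0\<close> makes the bound nonnegative.\<close>
  define r where "r = Max (insert 0 (w ` edges F))"
  have "w e \<le> r" if "e \<in> edges F" for e using that fin by (simp add: r_def)
  then have "(x, y) \<in> (light_edges G w r)\<^sup>*"
    using path_vertex_light_walk[OF F] path_ends[OF F] by blast
  moreover have "0 \<le> r" using fin by (simp add: r_def)
  ultimately show ?thesis by (auto simp: bottleneck_bounds_def)
qed

lemma less_bottleneckE:
  assumes "connected_graph G" "x \<in> verts G" "y \<in> verts G" "bottleneck G w x y < c"
  obtains r where "r \<in> bottleneck_bounds G w x y" "r < c"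
  using cInf_lessD[OF bottleneck_bounds_nonempty[OF assms(1-3)]] assms(4)
  unfolding bottleneck_def by blast

lemma pseudoultrametric_bottleneck:
  assumes conn: "connected_graph G"
  shows "pseudoultrametric_on (verts G) (bottleneck G w)"
proof -
  note nonempty = bottleneck_bounds_nonempty[OF conn]
  have nonneg: "0 \<le> bottleneck G w x y" if "x \<in> verts G" "y \<in> verts G" for x y
    unfolding bottleneck_def
    by (rule cInf_greatest[OF nonempty[OF that]]) (simp add: bottleneck_bounds_def)
  have "bottleneck G w x x = 0" if "x \<in> verts G" for x
    using nonneg[OF that that] bottleneck_le[of 0 G w x x] by (simp add: bottleneck_bounds_def)
  moreover have "bottleneck G w x y = bottleneck G w y x" for x y
  proof -
    have "bottleneck_bounds G w x y = bottleneck_bounds G w y x"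
      using light_walk_sym by (fastforce simp: bottleneck_bounds_def)
    then show ?thesis by (simp add: bottleneck_def)
  qed
  moreover have "bottleneck G w x y \<le> max (bottleneck G w x z) (bottleneck G w z y)"
    if vs: "x \<in> verts G" "y \<in> verts G" "z \<in> verts G" for x y z
  proof (rule dense_ge)
    fix c assume c: "max (bottleneck G w x z) (bottleneck G w z y) < c"
    obtain r where r: "r \<in> bottleneck_bounds G w x z" "r < c"
      using less_bottleneckE[OF conn vs(1,3), of w c] c by auto
    obtain s where s: "s \<in> bottleneck_bounds G w z y" "s < c"
      using less_bottleneckE[OF conn vs(3,2), of w c] c by auto
    have "(x, z) \<in> (light_edges G w (max r s))\<^sup>*" "(z, y) \<in> (light_edges G w (max r s))\<^sup>*"
      using r s by (auto simp: bottleneck_bounds_def intro: light_walk_mono)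
    then have "max r s \<in> bottleneck_bounds G w x y"
      using r by (auto simp: bottleneck_bounds_def)
    then show "bottleneck G w x y \<le> c"
      using bottleneck_le r s by fastforce
  qed
  ultimately show ?thesis
    using nonneg unfolding pseudoultrametric_on_def by blast
qed

text \<open>
  A single edge is a walk, so the bottleneck distance of adjacent vertices is at most the weight
  of their edge; it cannot be smaller, since every extension bounds it from below.
\<close>

lemma bottleneck_in_extensions:
  assumes G: "is_graph G" and conn: "connected_graph G"
    and w: "weight G w" "pseudoultrametrizable G w"
  shows "bottleneck G w \<in> pseudoultrametric_extensions G w"
proof -
  obtain d where d: "d \<in> pseudoultrametric_extensions G w"
    using w(2) by (auto simp: pseudoultrametrizable_def pseudoultrametric_extensions_def)
  have "bottleneck G w x y = w {x, y}" if e: "{x, y} \<in> edges G" for x y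
  proof (rule antisym)
    have "(x, y) \<in> light_edges G w (w {x, y})" "0 \<le> w {x, y}"
      using e w(1) by (auto simp: light_edges_def weight_def)
    then show "bottleneck G w x y \<le> w {x, y}"
      by (intro bottleneck_le) (auto simp: bottleneck_bounds_def)
  next
    note vs = edge_verts[OF G e]
    have "d x y \<le> bottleneck G w x y"
      unfolding bottleneck_def
      by (rule cInf_greatest[OF bottleneck_bounds_nonempty[OF conn vs(1,2)]])
        (auto simp: bottleneck_bounds_def intro: dist_le_if_light_walk[OF G d vs(1)])
    moreover have "d x y = w {x, y}"
      using d e vs by (simp add: pseudoultrametric_extensions_def extends_weight_def)
    ultimately show "w {x, y} \<le> bottleneck G w x y" by simp
  qed
  then show ?thesis
    using pseudoultrametric_bottleneck[OF conn]
    by (auto simp: pseudoultrametric_extensions_def extends_weight_def)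
qed

lemma bottleneck_zero_light_path:
  assumes G: "is_graph G" and conn: "connected_graph G"
    and vs: "u \<in> verts G" "v \<in> verts G" "u \<noteq> v"
    and zero: "bottleneck G w u v = 0" and "0 < c"
  shows "\<exists>F \<in> paths_between G u v. \<forall>e \<in> edges F. w e \<le> c"
proof -
  obtain r where "r \<in> bottleneck_bounds G w u v" "r < c"
    using less_bottleneckE[OF conn vs(1,2), of w c] zero \<open>0 < c\<close> by auto
  then have "(u, v) \<in> (light_edges G w c)\<^sup>*"
    by (auto simp: bottleneck_bounds_def intro: light_walk_mono)
  then show ?thesis using light_walk_path[OF G vs(1,3)] by metis
qed

section \<open>Light paths and independence of the upper limit\<close>

lemma mem_limsup_iff_infinite:
  fixes A :: "nat \<Rightarrow> 'a set"
  shows "x \<in> limsup A \<longleftrightarrow> infinite {j. x \<in> A j}"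
  by (auto simp: limsup_INF_SUP infinite_nat_iff_unbounded_le)

text \<open>
  A vertex on infinitely many of the paths is at distance \<open>0\<close> from \<open>u\<close>, hence so are any two of
  them from each other; an edge between them would have weight \<open>0\<close>.
\<close>

lemma independent_limsup_light_paths:
  assumes G: "is_graph G" and w: "strictly_positive G w"
    and d: "d \<in> pseudoultrametric_extensions G w" and u: "u \<in> verts G"
    and F: "\<And>j. F j \<in> paths_between G u v"
    and light: "\<And>j e. e \<in> edges (F j) \<Longrightarrow> w e \<le> inverse (real (Suc j))"
  shows "independent_set G (limsup (\<lambda>j. verts (F j)))"
proof -
  let ?L = "limsup (\<lambda>j. verts (F j))"
  have L: "x \<in> verts G \<and> d u x \<le> 0" if "x \<in> ?L" for x
  proof
    have inf: "infinite {j. x \<in> verts (F j)}" using that by (simp add: mem_limsup_iff_infinite)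
    then obtain j where "x \<in> verts (F j)" using infinite_imp_nonempty by fastforce
    then show "x \<in> verts G" using F[of j] by (auto simp: paths_between_def subgraph_of_def)
    show "d u x \<le> 0"
    proof (rule ccontr)
      assume "\<not> d u x \<le> 0"
      then obtain n where n: "inverse (real (Suc n)) < d u x"
        using reals_Archimedean[of "d u x"] by auto
      obtain j where j: "n \<le> j" "x \<in> verts (F j)"
        using inf by (auto simp: infinite_nat_iff_unbounded_le)
      have "d u x \<le> inverse (real (Suc j))"
        using path_vertex_light_walk[OF F light j(2)]
        by (intro dist_le_if_light_walk[OF G d u]) auto
      also have "\<dots> \<le> inverse (real (Suc n))" using j(1) by (intro le_imp_inverse_le) auto
      finally show False using n by simp
    qed
  qed
  have "{x, y} \<notin> edges G" if xy: "x \<in> ?L" "y \<in> ?L" for x y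
  proof
    assume e: "{x, y} \<in> edges G"
    have "d x y \<le> max (d x u) (d u y)" "d x u = d u x"
      using d u L[OF xy(1)] L[OF xy(2)]
      unfolding pseudoultrametric_extensions_def pseudoultrametric_on_def by blast+
    moreover have "d x y = w {x, y}"
      using d e L xy by (simp add: pseudoultrametric_extensions_def extends_weight_def)
    moreover have "0 < w {x, y}" using w e by (simp add: strictly_positive_def)
    ultimately show False using L[OF xy(1)] L[OF xy(2)] by linarith
  qed
  then show ?thesis using L by (auto simp: independent_set_def)
qed

section \<open>Weights from vertex heights\<close>

lemma pseudoultrametric_max_height:
  fixes f :: "'a \<Rightarrow> real"
  assumes "\<And>x. 0 \<le> f x"
  shows "pseudoultrametric_on X (\<lambda>x y. if x = y then 0 else max (f x) (f y))"
  using assms by (simp add: pseudoultrametric_on_def max_def)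

text \<open>
  Any function of the visiting indices that is at least each of them would serve as the
  denominator; the sum is one. A vertex visited infinitely often gets the limiting value \<open>0\<close>.
\<close>

definition visit_height :: "(nat \<Rightarrow> 'a set) \<Rightarrow> 'a \<Rightarrow> real" where
  "visit_height A x =
     (if infinite {j. x \<in> A j} then 0 else inverse (real (Suc (\<Sum>j | x \<in> A j. j))))"

lemma visit_height_nonneg: "0 \<le> visit_height A x"
  by (simp add: visit_height_def del: of_nat_Suc)

lemma visit_height_pos_iff: "0 < visit_height A x \<longleftrightarrow> x \<notin> limsup A"
  by (auto simp: visit_height_def mem_limsup_iff_infinite simp del: of_nat_Suc)

lemma visit_height_le:
  assumes "x \<in> A j"
  shows "visit_height A x \<le> inverse (real (Suc j))"
proof (cases "infinite {j. x \<in> A j}")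
  case True
  then show ?thesis by (simp add: visit_height_def)
next
  case False
  then have "j \<le> (\<Sum>j | x \<in> A j. j)" using assms by (intro member_le_sum) auto
  then have "inverse (real (Suc (\<Sum>j | x \<in> A j. j))) \<le> inverse (real (Suc j))"
    by (intro le_imp_inverse_le) (simp_all del: of_nat_Suc)
  then show ?thesis using False by (simp add: visit_height_def del: of_nat_Suc)
qed

definition height_weight :: "('a \<Rightarrow> real) \<Rightarrow> 'a set \<Rightarrow> real" where
  "height_weight f e = Max (f ` e)"

lemma height_weight_pair: "height_weight f {x, y} = max (f x) (f y)"
  by (simp add: height_weight_def)

lemma pseudoultrametrizable_height_weight:
  assumes G: "is_graph G" and f: "\<And>x. 0 \<le> f x"
  shows "pseudoultrametrizable G (height_weight f)"
proof -
  have "extends_weight G (height_weight f) (\<lambda>x y. if x = y then 0 else max (f x) (f y))"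
    unfolding extends_weight_def
  proof (intro ballI impI)
    fix x y assume "{x, y} \<in> edges G"
    then have "x \<noteq> y" by (rule edge_verts(3)[OF G])
    then show "(if x = y then 0 else max (f x) (f y)) = height_weight f {x, y}"
      by (simp add: height_weight_pair)
  qed
  then show ?thesis
    unfolding pseudoultrametrizable_def
    by (intro exI conjI) (rule pseudoultrametric_max_height[OF f])
qed

text \<open>An edge with both ends of height \<open>0\<close> would join two vertices of the upper limit.\<close>

lemma strictly_positive_visit_height:
  assumes G: "is_graph G" and indep: "independent_set G (limsup A)"
  shows "strictly_positive G (height_weight (visit_height A))"
  unfolding strictly_positive_def
proof
  fix e assume e: "e \<in> edges G"
  then obtain x y where xy: "e = {x, y}" using G unfolding is_graph_def by blast
  then have "x \<notin> limsup A \<or> y \<notin> limsup A" using e indep by (auto simp: independent_set_def)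
  then show "0 < height_weight (visit_height A) e"
    by (auto simp: xy height_weight_pair less_max_iff_disj visit_height_pos_iff)
qed

lemma visit_height_weight_forces_zero:
  assumes G: "is_graph G" and F: "\<And>j. F j \<in> paths_between G u v"
    and d: "d \<in> pseudoultrametric_extensions G (height_weight (visit_height (\<lambda>j. verts (F j))))"
  shows "d u v = 0"
proof -
  let ?w = "height_weight (visit_height (\<lambda>j. verts (F j)))"
  have "u \<in> verts G" "v \<in> verts G"
    using path_ends[OF F[of 0]] F[of 0] by (auto simp: paths_between_def subgraph_of_def)
  have bound: "d u v \<le> inverse (real (Suc j))" for j
  proof -
    have "?w e \<le> inverse (real (Suc j))" if e: "e \<in> edges (F j)" for e
    proof -
      have "is_graph (F j)" using F[of j] by (simp add: paths_between_def subgraph_of_def)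
      then obtain x y where "e = {x, y}" "x \<in> verts (F j)" "y \<in> verts (F j)"
        using e unfolding is_graph_def by blast
      then show ?thesis by (simp add: height_weight_pair visit_height_le del: of_nat_Suc)
    qed
    then have "(u, v) \<in> (light_edges G ?w (inverse (real (Suc j))))\<^sup>*"
      using path_vertex_light_walk[OF F _ path_ends(2)[OF F]] by blast
    then show ?thesis
      by (intro dist_le_if_light_walk[OF G d \<open>u \<in> verts G\<close>]) auto
  qed
  have "\<not> 0 < d u v"
  proof
    assume "0 < d u v"
    then obtain n where "inverse (real (Suc n)) < d u v" using reals_Archimedean by blast
    then show False using bound[of n] by simp
  qed
  moreover have "0 \<le> d u v"
    using d \<open>u \<in> verts G\<close> \<open>v \<in> verts G\<close>
    by (simp add: pseudoultrametric_extensions_def pseudoultrametric_on_def)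
  ultimately show ?thesis by simp
qed

section \<open>The characterization\<close>

theorem corollary4p6:
  fixes G :: "'a ugraph"
  assumes "is_graph G" and "connected_graph G" and "edges G \<noteq> {}"
  shows "(\<exists>w. weight G w \<and> strictly_positive G w \<and> pseudoultrametrizable G w \<and>
            \<not> (\<exists>d \<in> pseudoultrametric_extensions G w. ultrametric_on (verts G) d))
     \<longleftrightarrow>
         (\<exists>u \<in> verts G. \<exists>v \<in> verts G. u \<noteq> v \<and>
            (\<exists>F :: nat \<Rightarrow> 'a ugraph. (\<forall>j. F j \<in> paths_between G u v) \<and>
               independent_set G (limsup (\<lambda>j. verts (F j)))))"
    (is "?weight \<longleftrightarrow> ?paths")
proof
  assume ?weight
  then obtain w where w: "weight G w" "strictly_positive G w" "pseudoultrametrizable G w"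
    and no_ultra: "\<And>d. d \<in> pseudoultrametric_extensions G w \<Longrightarrow> \<not> ultrametric_on (verts G) d"
    by blast
  have ext: "bottleneck G w \<in> pseudoultrametric_extensions G w"
    using bottleneck_in_extensions[OF assms(1,2) w(1,3)] .
  then obtain u v where uv: "u \<in> verts G" "v \<in> verts G" "u \<noteq> v" "bottleneck G w u v = 0"
    using no_ultra[OF ext] by (auto simp: ultrametric_on_def pseudoultrametric_extensions_def)
  have "\<forall>j. \<exists>F. F \<in> paths_between G u v \<and> (\<forall>e \<in> edges F. w e \<le> inverse (real (Suc j)))"
    using bottleneck_zero_light_path[OF assms(1,2) uv] by (simp add: Bex_def del: of_nat_Suc)
  then obtain F where F: "\<And>j. F j \<in> paths_between G u v"
      "\<And>j e. e \<in> edges (F j) \<Longrightarrow> w e \<le> inverse (real (Suc j))"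
    by metis
  have "independent_set G (limsup (\<lambda>j. verts (F j)))"
    using independent_limsup_light_paths[OF assms(1) w(2) ext uv(1) F] .
  then show ?paths using uv F(1) by blast
next
  assume ?paths
  then obtain u v F where uv: "u \<in> verts G" "v \<in> verts G" "u \<noteq> v"
    and F: "\<And>j. F j \<in> paths_between G u v"
    and indep: "independent_set G (limsup (\<lambda>j. verts (F j)))"
    by blast
  let ?w = "height_weight (visit_height (\<lambda>j. verts (F j)))"
  have "strictly_positive G ?w"
    using strictly_positive_visit_height[OF assms(1) indep] .
  moreover from this have "weight G ?w"
    by (auto simp: strictly_positive_def weight_def intro: less_imp_le)
  moreover have "pseudoultrametrizable G ?w"
    using assms(1) visit_height_nonneg by (rule pseudoultrametrizable_height_weight)
  moreover have "\<not> ultrametric_on (verts G) d" if "d \<in> pseudoultrametric_extensions G ?w" for d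
    using visit_height_weight_forces_zero[OF assms(1) F that] uv by (auto simp: ultrametric_on_def)
  ultimately show ?weight by blast
qed

end
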